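(* Let $\zeta_5=e^{2\pi i/5}$, and for $\tau\in\mathbb{H}^2$ put $A=\theta[1;\tfrac15]$, $B=\theta[1;\tfrac35]$ and $c_k=\theta[\tfrac15;\tfrac k5]$ for $k\in\{1,3,5,7,9\}$ (theta constants at $\zeta=0$). Then for every $\tau\in\mathbb{H}^2$: $$\frac AB=\frac{c_1^2c_3-\zeta_5^4c_9^2c_7}{\zeta_5^2c_7^2c_1-\zeta_5^2c_3^2c_9},\qquad \frac AB=\frac{\zeta_5^2c_5^2c_7+c_3^2c_1}{c_1^2c_5+\zeta_5^2c_7^2c_3},$$ $$\frac AB=\frac{\zeta_5^2c_7^2c_5-\zeta_5^2c_9^2c_1}{c_1^2c_7+\zeta_5^2c_5^2c_9},\qquad \frac AB=\frac{-c_1^2c_9+c_3^2c_5}{\zeta_5^2c_9^2c_3+c_5^2c_1},$$ $$\frac AB=\frac{\zeta_5^2c_7^2c_9+c_5^2c_3}{c_3^2c_7+\zeta_5^2c_9^2c_5}.$$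
   Context: Let $\mathbb{H}^2=\{\tau\in\mathbb{C}:\Im\tau>0\}$. For $(\epsilon,\epsilon')\in\mathbb{R}^2$, $$\theta[\epsilon;\epsilon'](\zeta,\tau)=\sum_{n\in\mathbb{Z}}\exp\Big(2\pi i\Big[\tfrac12\big(n+\tfrac{\epsilon}{2}\big)^2\tau+\big(n+\tfrac{\epsilon}{2}\big)\big(\zeta+\tfrac{\epsilon'}{2}\big)\Big]\Big),$$ and $\theta[\epsilon;\epsilon']=\theta[\epsilon;\epsilon'](0,\tau)$ denotes the theta constant, a function of $\tau$. *)

theory Defs
  imports "HOL-Analysis.Analysis"
begin

definition theta_char :: "real \<Rightarrow> real \<Rightarrow> complex \<Rightarrow> complex \<Rightarrow> complex" where
  "theta_char e e' z t =
     (\<Sum>\<^sub>\<infinity>n::int. exp (2 * pi * \<i> *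
        ((1/2) * (of_int n + of_real e / 2)^2 * t
         + (of_int n + of_real e / 2) * (z + of_real e' / 2))))"

definition theta_const :: "real \<Rightarrow> real \<Rightarrow> complex \<Rightarrow> complex" where
  "theta_const e e' t = theta_char e e' 0 t"

definition zeta5 :: complex where
  "zeta5 = exp (2 * pi * \<i> / 5)"

end

theory Submission
  imports Defs
begin

text \<open>
  Write T(z) for the odd theta function with characteristic [1; 1]. Up to signs and exponential factors,
  A and B are the values of T at 2/5 and 1/5, and the constants c_k are its values at the points
  v + j/5 with v = -2\<tau>/5 and j = -2, ..., 2. The three-term relation for T, applied to two
  of these points and to d = 1/5 or d = 2/5, shows that each numerator times a suitable T(v + j/5) is
  A^2 B T(2v + i/5), up to a common factor, and that the matching denominator times the same value
  is A B^2 T(2v + i/5). The quotients then follow, since T vanishes only at lattice points. The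
  latter is read off the Jacobi triple product, obtained as the limit of its finite
  (q-binomial) form.
\<close>

subsection \<open>Gaussian series and the Jacobi triple product\<close>

text \<open>Once \<open>a * n + b' \<le> -1\<close>, the quadratic exponent is at most
  \<open>c - n\<close>, so a geometric series dominates the nonnegative half. The negative half is
  the same series with \<open>b\<close> negated.\<close>

lemma summable_on_int_gaussian:
  fixes a b c :: real
  assumes "a < 0"
  shows "(\<lambda>n::int. exp (a * (of_int n)\<^sup>2 + b * of_int n + c)) summable_on UNIV"
proof -
  have half: "(\<lambda>n::nat. exp (a * (real n)\<^sup>2 + b' * real n + c)) summable_on UNIV" for b'
  proof -
    obtain N :: nat where N: "real N \<ge> (1 + \<bar>b'\<bar>) / - a"
      using real_arch_simple by blast
    have "summable (\<lambda>n. exp c * exp (-1::real) ^ n)"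
      by (intro summable_mult summable_geometric) auto
    then have "summable (\<lambda>n::nat. exp (a * (real n)\<^sup>2 + b' * real n + c))"
    proof (rule summable_comparison_test_ev[rotated], intro eventually_sequentiallyI[of N])
      fix n assume "N \<le> n"
      then have "(1 + \<bar>b'\<bar>) / - a \<le> real n"
        using N by linarith
      then have "a * real n + b' \<le> -1"
        using assms by (simp add: field_simps)
      then have "(a * real n + b') * real n \<le> -1 * real n"
        by (intro mult_right_mono) auto
      then have "a * (real n)\<^sup>2 + b' * real n + c \<le> c + real n * (-1)"
        by (simp add: algebra_simps power2_eq_square)
      then show "norm (exp (a * (real n)\<^sup>2 + b' * real n + c)) \<le> exp c * exp (-1) ^ n"
        by (simp flip: exp_of_nat_mult exp_add)
    qed
    then show ?thesis
      by (subst summable_on_UNIV_nonneg_real_iff) auto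
  qed
  have pos: "(\<lambda>n::int. exp (a * (of_int n)\<^sup>2 + b * of_int n + c)) summable_on {0..}"
    using half[of b]
    by (rule summable_on_reindex_bij_witness[of _ nat int, THEN iffD1, rotated -1]) auto
  have neg: "(\<lambda>n::int. exp (a * (of_int n)\<^sup>2 + b * of_int n + c)) summable_on {..0}"
    using half[of "-b"]
    by (rule summable_on_reindex_bij_witness[of _ "\<lambda>k. nat (-k)" "\<lambda>n. - int n", THEN iffD1, rotated -1]) auto
  have "{..<0::int} \<subseteq> {..0}" by auto
  then have "(\<lambda>n::int. exp (a * (of_int n)\<^sup>2 + b * of_int n + c)) summable_on ({0..} \<union> {..<0})"
    by (intro summable_on_Un_disjoint pos summable_on_subset_banach[OF neg]) auto
  moreover have "{0..} \<union> {..<0::int} = UNIV" by auto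
  ultimately show ?thesis by simp
qed

lemma abs_summable_on_int_gaussian:
  fixes a b c :: complex
  assumes "Re a < 0"
  shows "(\<lambda>n::int. norm (exp (a * (of_int n)\<^sup>2 + b * of_int n + c))) summable_on UNIV"
proof -
  have "norm (exp (a * (of_int n)\<^sup>2 + b * of_int n + c))
      = exp (Re a * (of_int n)\<^sup>2 + Re b * of_int n + Re c)" for n :: int
  proof -
    have "Re (a * (of_int n)\<^sup>2 + b * of_int n + c) = Re a * (of_int n)\<^sup>2 + Re b * of_int n + Re c"
      by (simp add: power2_eq_square)
    then show ?thesis by (simp add: norm_exp_eq_Re)
  qed
  then show ?thesis
    using summable_on_int_gaussian[OF assms, of "Re b" "Re c"] by simp
qed

text \<open>This is Tannery's theorem, carried from the naturals to the integers by the enumeration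
  \<open>int_decode\<close>. It justifies passing to the limit termwise in the finite triple
  product.\<close>

lemma has_sum_int_dominated_convergence:
  fixes f :: "nat \<Rightarrow> int \<Rightarrow> complex"
  assumes sum: "\<And>n. (f n has_sum S n) UNIV"
    and lim: "\<And>k. (\<lambda>n. f n k) \<longlonglongrightarrow> g k"
    and bound: "\<And>n k. norm (f n k) \<le> h k"
    and h: "h summable_on UNIV"
  shows "S \<longlonglongrightarrow> infsum g UNIV"
proof -
  have bij: "bij_betw int_decode UNIV UNIV"
    by (simp add: bij_int_decode)
  have S: "(\<Sum>i. f n (int_decode i)) = S n" for n
    using has_sum_reindex_bij_betw[OF bij, of "f n" "S n"] sum[of n]
    by (auto intro!: sums_unique[symmetric] has_sum_imp_sums)
  have "(\<lambda>i. h (int_decode i)) summable_on UNIV"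
    using h summable_on_reindex_bij_betw[OF bij] by blast
  then have h': "summable (\<lambda>i. h (int_decode i))"
    by (rule summable_on_imp_summable)
  have "summable (\<lambda>i. norm (g (int_decode i))) \<and>
      (\<lambda>n. \<Sum>i. f n (int_decode i)) \<longlonglongrightarrow> (\<Sum>i. g (int_decode i))"
    using tannerys_theorem[of "\<lambda>i n. f n (int_decode i)" "\<lambda>i. g (int_decode i)" sequentially
        "\<lambda>i. h (int_decode i)"] lim bound h' by (simp add: always_eventually)
  moreover from this have "((\<lambda>i. g (int_decode i)) has_sum (\<Sum>i. g (int_decode i))) UNIV"
    by (intro norm_summable_imp_has_sum summable_sums) (auto intro: summable_norm_cancel)
  then have "infsum g UNIV = (\<Sum>i. g (int_decode i))"
    using infsumI[OF has_sum_reindex_bij_betw[OF bij, of g, THEN iffD1]] by simp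
  ultimately show ?thesis
    by (simp only: S)
qed

text \<open>An absolutely convergent product vanishes only if one of its factors does. This is how
  zeros of the theta series are located.\<close>

lemma prod_one_plus_tendsto_nonzero:
  fixes a :: "nat \<Rightarrow> complex"
  assumes "summable (\<lambda>n. norm (a n))" "\<And>n. 1 + a n \<noteq> 0"
  obtains L where "(\<lambda>n. \<Prod>i<n. 1 + a i) \<longlonglongrightarrow> L" "L \<noteq> 0"
proof -
  have "convergent_prod (\<lambda>n. 1 + a n)"
    using assms by (intro summable_imp_convergent_prod_complex) (auto simp: add_eq_0_iff)
  then obtain L where "(\<lambda>n. \<Prod>i\<le>n. 1 + a i) \<longlonglongrightarrow> L" "L \<noteq> 0"
    using convergent_prod_iff_nz_lim[of "\<lambda>n. 1 + a n"] assms(2) by auto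
  then show ?thesis
    by (intro that) (simp_all add: LIMSEQ_lessThan_iff_atMost)
qed

section \<open>The finite triple product\<close>

text \<open>The q-Pochhammer symbol (q^2; q^2)_n with q = exp h. Using \<open>h\<close> as the
  parameter lets powers of q merge with other exponentials by adding exponents.\<close>

definition qfact :: "complex \<Rightarrow> nat \<Rightarrow> complex" where
  "qfact h n = (\<Prod>j<n. 1 - exp (2 * h * of_nat (Suc j)))"

text \<open>
  With the value 0 at negative integers, the recursion for the reciprocals of (q^2; q^2)_k, where
  q = exp h, holds for all integers, so that the finite triple product needs no boundary cases.
\<close>

definition qfact_recip :: "complex \<Rightarrow> int \<Rightarrow> complex" where
  "qfact_recip h k = (if k < 0 then 0 else 1 / qfact h (nat k))"

lemma one_minus_exp_nonzero:
  assumes "Re h < 0" "n > 0"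
  shows "1 - exp (2 * h * of_nat n) \<noteq> 0"
proof -
  have "norm (exp (2 * h * of_nat n)) < 1"
    using assms by (simp add: norm_exp_eq_Re mult_neg_pos)
  then show ?thesis by (metis eq_iff_diff_eq_0 less_irrefl norm_one)
qed

lemma qfact_nonzero: "Re h < 0 \<Longrightarrow> qfact h n \<noteq> 0"
  unfolding qfact_def using one_minus_exp_nonzero[of h "Suc _"] by auto

text \<open>For positive \<open>k\<close> the last factor cancels. At \<open>k = 0\<close> the
  factor 1 - exp 0 vanishes and matches the default value at -1; for negative \<open>k\<close> both
  sides are 0.\<close>

lemma qfact_recip_pred:
  assumes "Re h < 0"
  shows "qfact_recip h (k - 1) = (1 - exp (2 * h * of_int k)) * qfact_recip h k"
proof (cases "k > 0")
  case True
  then have k: "k = int (Suc (nat (k - 1)))" by simp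
  define m where "m = nat (k - 1)"
  have k: "k = int (Suc m)" using k by (simp only: m_def)
  define x where "x = 1 - exp (2 * h * of_nat (Suc m))"
  have "x \<noteq> 0"
    unfolding x_def by (rule one_minus_exp_nonzero[OF assms]) simp
  have "qfact h (Suc m) = qfact h m * x"
    by (simp add: qfact_def x_def)
  moreover have "nat k = Suc m" "nat (k - 1) = m" "0 < k"
    unfolding k by simp_all
  ultimately have "qfact_recip h k = 1 / (qfact h m * x)" "qfact_recip h (k - 1) = 1 / qfact h m"
    by (simp_all add: qfact_recip_def)
  moreover have "1 - exp (2 * h * of_int k) = x"
    by (simp add: x_def k)
  ultimately show ?thesis
    using \<open>x \<noteq> 0\<close> by simp
next
  case False
  then show ?thesis by (cases "k = 0") (auto simp: qfact_recip_def)
qed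

lemma summable_norm_exp_linear:
  assumes "Re h < 0"
  shows "summable (\<lambda>n. norm (exp (h * of_nat n + c)))"
proof -
  have "summable (\<lambda>n. exp (Re c) * exp (Re h) ^ n)"
    using assms by (intro summable_mult summable_geometric) auto
  moreover have "norm (exp (h * of_nat n + c)) = exp (Re c) * exp (Re h) ^ n" for n
    by (simp add: exp_add exp_of_nat2_mult norm_mult norm_power)
  ultimately show ?thesis by simp
qed

text \<open>The coefficient is the q-binomial coefficient of 2n over n + k in base q^2, which is 0
  for |k| > n. In the induction, the two new factors expand into terms that shift \<open>k\<close>
  by -1, 0 or 1, and the coefficients are compared.\<close>

lemma finite_jacobi_triple_product:
  fixes h s :: complex
  assumes h: "Re h < 0"
  shows "((\<lambda>k::int. exp (h * (of_int k)\<^sup>2 + s * of_int k)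
             * (qfact h (2 * n) * qfact_recip h (int n + k) * qfact_recip h (int n - k)))
          has_sum (\<Prod>j<n. (1 + exp (h * (2 * of_nat j + 1) + s)) * (1 + exp (h * (2 * of_nat j + 1) - s)))) UNIV"
proof (induction n)
  case 0
  \<comment> \<open>Unless \<open>k = 0\<close>, one of \<open>k\<close> and \<open>- k\<close> is
    negative, so the default value 0 leaves a single term.\<close>
  have "((\<lambda>k::int. exp (h * (of_int k)\<^sup>2 + s * of_int k)
             * (qfact h (2 * 0) * qfact_recip h (int 0 + k) * qfact_recip h (int 0 - k)))
          has_sum 1) {0}"
    by (rule has_sum_finiteI) (auto simp: qfact_def qfact_recip_def)
  also have "?this \<longleftrightarrow> ((\<lambda>k::int. exp (h * (of_int k)\<^sup>2 + s * of_int k)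
             * (qfact h (2 * 0) * qfact_recip h (int 0 + k) * qfact_recip h (int 0 - k)))
          has_sum 1) UNIV"
    by (rule has_sum_cong_neutral) (auto simp: qfact_recip_def)
  finally show ?case by simp
next
  case (Suc n)
  let ?e = "\<lambda>k::int. exp (h * (of_int k)\<^sup>2 + s * of_int k)"
  let ?D = "qfact_recip h"
  let ?a = "\<lambda>n k. ?e k * (qfact h (2 * n) * ?D (int n + k) * ?D (int n - k))"
  let ?P = "\<lambda>n. \<Prod>j<n. (1 + exp (h * (2 * of_nat j + 1) + s)) * (1 + exp (h * (2 * of_nat j + 1) - s))"
  \<comment> \<open>With u = q^(2n+1) the new factors multiply to 1 + u^2 + u exp s + u exp (-s),
    because exp s and exp (-s) cancel in the product.\<close>
  define u where "u = exp (h * (2 * of_nat n + 1))"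
  have "((\<lambda>k. ?a n (k - 1)) has_sum ?P n) UNIV"
    using has_sum_reindex_bij_witness[of UNIV "\<lambda>k. k - 1" "\<lambda>k. k + 1" UNIV "\<lambda>k. ?a n (k - 1)" "?a n" "?P n" "?P n"] Suc
    by auto
  moreover have "((\<lambda>k. ?a n (k + 1)) has_sum ?P n) UNIV"
    using has_sum_reindex_bij_witness[of UNIV "\<lambda>k. k + 1" "\<lambda>k. k - 1" UNIV "\<lambda>k. ?a n (k + 1)" "?a n" "?P n" "?P n"] Suc
    by auto
  ultimately have "((\<lambda>k. (1 + u\<^sup>2) * ?a n k + (u * exp s * ?a n (k - 1) + u * exp (-s) * ?a n (k + 1)))
      has_sum ((1 + u\<^sup>2) * ?P n + (u * exp s * ?P n + u * exp (-s) * ?P n))) UNIV"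
    by (intro has_sum_add has_sum_cmult_right Suc)
  moreover have "(1 + u\<^sup>2) * ?P n + (u * exp s * ?P n + u * exp (-s) * ?P n) = ?P (Suc n)"
  proof -
    have "?P (Suc n) = ?P n * ((1 + u * exp s) * (1 + u * exp (-s)))"
      by (simp add: u_def exp_add exp_diff exp_minus field_simps)
    also have "\<dots> = ?P n * (1 + u\<^sup>2 * (exp s * exp (-s)) + u * exp s + u * exp (-s))"
      by (simp add: algebra_simps power2_eq_square)
    also have "exp s * exp (-s) = 1"
      by (simp flip: exp_add)
    finally show ?thesis by (simp add: algebra_simps)
  qed
  moreover have "(1 + u\<^sup>2) * ?a n k + (u * exp s * ?a n (k - 1) + u * exp (-s) * ?a n (k + 1))
      = ?a (Suc n) k" for k
  proof -
    \<comment> \<open>All reciprocals at level n are polynomial multiples of the two at level n + 1.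
      Taking \<open>r'\<close> as a separate variable with \<open>r * r' = 1\<close> keeps the
      remaining identity polynomial.\<close>
    define X Y where "X = ?D (int n + 1 + k)" and "Y = ?D (int n + 1 - k)"
    define Q r where "Q = exp (2 * h * of_nat n)" and "r = exp (2 * h * of_int k)"
    define p where "p = exp (2 * h)"
    define r' where "r' = exp (- 2 * h * of_int k)"
    have rr': "r * r' = 1" by (simp add: r_def r'_def flip: exp_add)
    have D1: "?D (int n + k) = (1 - p * Q * r) * X"
      using qfact_recip_pred[OF h, of "int n + 1 + k"]
      by (simp add: X_def p_def Q_def r_def algebra_simps flip: exp_add)
    have D2: "?D (int n - k) = (1 - p * Q * r') * Y"
      using qfact_recip_pred[OF h, of "int n + 1 - k"]
      by (simp add: Y_def p_def Q_def r'_def algebra_simps flip: exp_add)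
    have D3: "?D (int n + (k - 1)) = (1 - Q * r) * (1 - p * Q * r) * X"
    proof -
      have "?D (int n + (k - 1)) = (1 - Q * r) * ?D (int n + k)"
        using qfact_recip_pred[OF h, of "int n + k"]
        by (simp add: Q_def r_def algebra_simps flip: exp_add)
      then show ?thesis by (simp only: D1 mult.assoc)
    qed
    have D4: "?D (int n - (k + 1)) = (1 - Q * r') * (1 - p * Q * r') * Y"
    proof -
      have "?D (int n - (k + 1)) = (1 - Q * r') * ?D (int n - k)"
        using qfact_recip_pred[OF h, of "int n - k"]
        by (simp add: Q_def r'_def algebra_simps flip: exp_add)
      then show ?thesis by (simp only: D2 mult.assoc)
    qed
    have D5: "?D (int n - (k - 1)) = Y" "?D (int n + (k + 1)) = X"
      "?D (int (Suc n) + k) = X" "?D (int (Suc n) - k) = Y"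
      by (simp_all add: X_def Y_def algebra_simps)
    have E: "qfact h (2 * Suc n) = qfact h (2 * n) * (1 - p * Q\<^sup>2) * (1 - p\<^sup>2 * Q\<^sup>2)"
      by (simp add: qfact_def p_def Q_def algebra_simps power2_eq_square flip: exp_add)
    have u2: "u\<^sup>2 = p * Q\<^sup>2"
      by (simp add: u_def p_def Q_def algebra_simps power2_eq_square flip: exp_add)
    have e1: "u * exp s * ?e (k - 1) = p * Q * r' * ?e k"
      by (simp add: u_def p_def Q_def r'_def algebra_simps power2_eq_square flip: exp_add)
    have e2: "u * exp (-s) * ?e (k + 1) = p * Q * r * ?e k"
      by (simp add: u_def p_def Q_def r_def algebra_simps power2_eq_square flip: exp_add)
    have "(1 + u\<^sup>2) * ?a n k + (u * exp s * ?a n (k - 1) + u * exp (-s) * ?a n (k + 1))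
        = (1 + u\<^sup>2) * ?e k * (qfact h (2 * n) * ?D (int n + k) * ?D (int n - k))
        + (u * exp s * ?e (k - 1)) * (qfact h (2 * n) * ?D (int n + (k - 1)) * ?D (int n - (k - 1)))
        + (u * exp (-s) * ?e (k + 1)) * (qfact h (2 * n) * ?D (int n + (k + 1)) * ?D (int n - (k + 1)))"
      by (simp only: ac_simps)
    also have "\<dots> = ?e k * qfact h (2 * n) * X * Y *
        ((1 + p * Q\<^sup>2) * ((1 - p * Q * r) * (1 - p * Q * r'))
         + p * Q * r' * ((1 - Q * r) * (1 - p * Q * r))
         + p * Q * r * ((1 - Q * r') * (1 - p * Q * r')))"
      unfolding e1 e2 D1 D2 D3 D4 D5 u2 by (simp add: algebra_simps)
    also have "(1 + p * Q\<^sup>2) * ((1 - p * Q * r) * (1 - p * Q * r'))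
         + p * Q * r' * ((1 - Q * r) * (1 - p * Q * r))
         + p * Q * r * ((1 - Q * r') * (1 - p * Q * r')) = (1 - p * Q\<^sup>2) * (1 - p\<^sup>2 * Q\<^sup>2)"
      using rr' by algebra
    also have "?e k * qfact h (2 * n) * X * Y * ((1 - p * Q\<^sup>2) * (1 - p\<^sup>2 * Q\<^sup>2)) = ?a (Suc n) k"
      unfolding D5 E by (simp only: ac_simps)
    finally show ?thesis .
  qed
  ultimately show ?case
    by simp
qed

section \<open>The limit of the triple product\<close>

lemma exists_qfact_limit:
  assumes h: "Re h < 0"
  obtains L where "qfact h \<longlonglongrightarrow> L" "L \<noteq> 0"
proof -
  let ?a = "\<lambda>n. - exp (2 * h * of_nat n + 2 * h)"
  have eq: "1 + ?a n = 1 - exp (2 * h * of_nat (Suc n))" for n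
    by (simp add: algebra_simps)
  have "summable (\<lambda>n. norm (?a n))"
    using summable_norm_exp_linear[of "2 * h" "2 * h"] h by simp
  moreover have "1 + ?a n \<noteq> 0" for n
    unfolding eq by (rule one_minus_exp_nonzero[OF h]) simp
  ultimately obtain L where "(\<lambda>n. \<Prod>i<n. 1 + ?a i) \<longlonglongrightarrow> L" "L \<noteq> 0"
    by (rule prod_one_plus_tendsto_nonzero)
  moreover have "qfact h = (\<lambda>n. \<Prod>i<n. 1 + ?a i)"
    unfolding qfact_def eq by simp
  ultimately show ?thesis
    using that by simp
qed

text \<open>As n grows, the q-binomial coefficients stay bounded and tend to 1 / L with L = (q^2;
  q^2)_infinity. Hence the series divided by L equals the infinite product, none of whose factors
  vanishes.\<close>

lemma gaussian_series_nonzero: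
  fixes h s :: complex
  assumes h: "Re h < 0"
    and plus: "\<And>j::nat. 1 + exp (h * (2 * of_nat j + 1) + s) \<noteq> 0"
    and minus: "\<And>j::nat. 1 + exp (h * (2 * of_nat j + 1) - s) \<noteq> 0"
  shows "(\<Sum>\<^sub>\<infinity>k::int. exp (h * (of_int k)\<^sup>2 + s * of_int k)) \<noteq> 0"
proof -
  let ?e = "\<lambda>k::int. exp (h * (of_int k)\<^sup>2 + s * of_int k)"
  obtain L where L: "qfact h \<longlonglongrightarrow> L" "L \<noteq> 0"
    using exists_qfact_limit[OF h] .
  have recip: "(\<lambda>n. 1 / qfact h n) \<longlonglongrightarrow> 1 / L"
    using L by (intro tendsto_divide) auto
  obtain M where M: "\<And>n. norm (qfact h n) \<le> M" "M > 0"
    using convergent_imp_Bseq[of "qfact h"] L by (auto simp: convergent_def Bseq_def)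
  obtain K where K: "\<And>n. norm (1 / qfact h n) \<le> K" "K > 0"
    using convergent_imp_Bseq[of "\<lambda>n. 1 / qfact h n"] recip unfolding convergent_def Bseq_def by metis
  have D_bound: "norm (qfact_recip h k) \<le> K" for k
    using K(1)[of "nat k"] K(2) by (simp add: qfact_recip_def)
  \<comment> \<open>For negative \<open>k\<close> the default value 0 occurs while n < -k, so the
    agreement with \<open>1 / qfact\<close> is only eventual.\<close>
  have D_lim: "(\<lambda>n. qfact_recip h (int n + k)) \<longlonglongrightarrow> 1 / L" for k
  proof -
    have "filterlim (\<lambda>n. nat (int n + k)) at_top sequentially"
      unfolding filterlim_at_top
    proof
      fix Z :: nat
      show "eventually (\<lambda>n. Z \<le> nat (int n + k)) sequentially"
        using eventually_ge_at_top[of "Z + nat (- k)"] by eventually_elim linarith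
    qed
    then have "(\<lambda>n. 1 / qfact h (nat (int n + k))) \<longlonglongrightarrow> 1 / L"
      by (rule filterlim_compose[OF recip])
    moreover have "eventually (\<lambda>n. 1 / qfact h (nat (int n + k)) = qfact_recip h (int n + k)) sequentially"
      using eventually_ge_at_top[of "nat (-k)"]
      by eventually_elim (auto simp: qfact_recip_def)
    ultimately show ?thesis
      by (rule Lim_transform_eventually)
  qed
  let ?c = "\<lambda>n k. qfact h (2 * n) * qfact_recip h (int n + k) * qfact_recip h (int n - k)"
  let ?P = "\<lambda>n. \<Prod>j<n. (1 + exp (h * (2 * of_nat j + 1) + s)) * (1 + exp (h * (2 * of_nat j + 1) - s))"
  have "?P \<longlonglongrightarrow> (\<Sum>\<^sub>\<infinity>k. ?e k * (1 / L))"
  proof (rule has_sum_int_dominated_convergence[OF finite_jacobi_triple_product[OF h]])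
    fix k :: int
    have "(\<lambda>n. qfact h (2 * n)) \<longlonglongrightarrow> L"
      by (rule filterlim_compose[OF L(1)]) (simp add: filterlim_subseq strict_mono_def)
    moreover have "(\<lambda>n. qfact_recip h (int n - k)) \<longlonglongrightarrow> 1 / L"
      using D_lim[of "-k"] by simp
    ultimately have "(\<lambda>n. ?e k * ?c n k) \<longlonglongrightarrow> ?e k * (L * (1 / L) * (1 / L))"
      by (intro tendsto_intros D_lim)
    then show "(\<lambda>n. ?e k * ?c n k) \<longlonglongrightarrow> ?e k * (1 / L)"
      using L(2) by simp
  next
    fix n :: nat and k :: int
    have "norm (?c n k) \<le> M * K * K"
      unfolding norm_mult using M K by (intro mult_mono D_bound) auto
    then show "norm (?e k * ?c n k) \<le> norm (?e k) * (M * K * K)"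
      unfolding norm_mult[of "?e k"] by (rule mult_left_mono) simp
  next
    show "(\<lambda>k. norm (?e k) * (M * K * K)) summable_on UNIV"
      using abs_summable_on_int_gaussian[OF h, of s 0] by (intro summable_on_cmult_left) simp
  qed
  moreover obtain P where "?P \<longlonglongrightarrow> P" "P \<noteq> 0"
  proof -
    have lin: "exp (h * (2 * of_nat j + 1) + c) = exp (2 * h * of_nat j + (h + c))" for j c
      by (simp add: algebra_simps)
    obtain P1 where P1: "(\<lambda>n. \<Prod>j<n. 1 + exp (h * (2 * of_nat j + 1) + s)) \<longlonglongrightarrow> P1" "P1 \<noteq> 0"
      by (rule prod_one_plus_tendsto_nonzero[of "\<lambda>j. exp (h * (2 * of_nat j + 1) + s)"])
        (use plus h summable_norm_exp_linear[of "2 * h" "h + s"] in \<open>simp_all only: lin, auto\<close>)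
    obtain P2 where P2: "(\<lambda>n. \<Prod>j<n. 1 + exp (h * (2 * of_nat j + 1) - s)) \<longlonglongrightarrow> P2" "P2 \<noteq> 0"
      by (rule prod_one_plus_tendsto_nonzero[of "\<lambda>j. exp (h * (2 * of_nat j + 1) - s)"])
        (use minus h summable_norm_exp_linear[of "2 * h" "h - s"] lin[of _ "-s"] in \<open>simp_all, auto?\<close>)
    have "?P \<longlonglongrightarrow> P1 * P2"
      unfolding prod.distrib by (intro tendsto_mult P1 P2)
    then show ?thesis
      using that[of "P1 * P2"] P1 P2 by simp
  qed
  ultimately have "(\<Sum>\<^sub>\<infinity>k. ?e k * (1 / L)) \<noteq> 0"
    using LIMSEQ_unique by blast
  then show ?thesis
    unfolding infsum_cmult_left' by simp
qed

section \<open>Zeros of the odd theta function\<close>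

text \<open>Up to an exponential factor this theta function is a Gaussian series, so a zero needs a
  vanishing factor of the triple product. That makes (j+1) t + z or j t - z - 1 an integer for some
  natural j.\<close>

lemma theta_char_11_eq_0:
  assumes t: "Im t > 0" and zero: "theta_char 1 1 z t = 0"
  obtains m n :: int where "z = of_int m * t + of_int n"
proof (rule ccontr)
  assume "\<not> thesis"
  then have not_lattice: "z \<noteq> of_int m * t + of_int n" for m n :: int
    using that by blast
  \<comment> \<open>The linear part of (n + 1/2)^2 and the half from the second characteristic go
    into \<open>?s\<close>.\<close>
  let ?h = "pi * \<i> * t" and ?s = "pi * \<i> * t + 2 * pi * \<i> * (z + 1/2)"
  \<comment> \<open>A factor vanishes when its exponential is -1; splitting off pi i turns this into
    exp (2 pi i w) = 1.\<close>
  have minus1: "exp (pi * \<i> + c) = - exp c" for c :: complex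
    by (simp add: exp_add)
  have exp_eq_1: "\<exists>n::int. w = of_int n" if "exp (2 * pi * \<i> * w) = 1" for w :: complex
  proof -
    have "exp (2 * pi * \<i> * w) = exp 0"
      using that by simp
    then obtain n :: int where "2 * pi * \<i> * w = 0 + (of_int (2 * n) * pi) * \<i>"
      unfolding exp_eq by blast
    then have "w = of_int n" by simp
    then show ?thesis by blast
  qed
  have "(\<Sum>\<^sub>\<infinity>k::int. exp (?h * (of_int k)\<^sup>2 + ?s * of_int k)) \<noteq> 0"
  proof (rule gaussian_series_nonzero)
    fix j :: nat
    show "1 + exp (?h * (2 * of_nat j + 1) + ?s) \<noteq> 0"
    proof
      assume "1 + exp (?h * (2 * of_nat j + 1) + ?s) = 0"
      moreover have "?h * (2 * of_nat j + 1) + ?s = pi * \<i> + 2 * pi * \<i> * (of_nat (Suc j) * t + z)"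
        by (simp add: algebra_simps)
      ultimately have "exp (2 * pi * \<i> * (of_nat (Suc j) * t + z)) = 1"
        by (simp only: minus1) simp
      then obtain n :: int where "of_nat (Suc j) * t + z = of_int n"
        using exp_eq_1 by blast
      then show False
        using not_lattice[of "- int (Suc j)" n] by (simp add: algebra_simps)
    qed
    show "1 + exp (?h * (2 * of_nat j + 1) - ?s) \<noteq> 0"
    proof
      assume "1 + exp (?h * (2 * of_nat j + 1) - ?s) = 0"
      moreover have "?h * (2 * of_nat j + 1) - ?s = pi * \<i> + 2 * pi * \<i> * (of_nat j * t - z - 1)"
        by (simp add: algebra_simps)
      ultimately have "exp (2 * pi * \<i> * (of_nat j * t - z - 1)) = 1"
        by (simp only: minus1) simp
      then obtain n :: int where "of_nat j * t - z - 1 = of_int n"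
        using exp_eq_1 by blast
      then show False
        using not_lattice[of "int j" "- n - 1"] by (simp add: algebra_simps)
    qed
  qed (use t in simp)
  moreover have "theta_char 1 1 z t = exp (pi * \<i> * t / 4 + pi * \<i> * (z + 1/2))
      * (\<Sum>\<^sub>\<infinity>k::int. exp (?h * (of_int k)\<^sup>2 + ?s * of_int k))"
    unfolding theta_char_def infsum_cmult_right'[symmetric] exp_add[symmetric]
    by (intro infsum_cong arg_cong[where f = exp]) (simp add: field_simps power2_eq_square)
  ultimately show False
    using zero by simp
qed

subsection \<open>Addition formulas\<close>

definition theta_term :: "real \<Rightarrow> real \<Rightarrow> complex \<Rightarrow> complex \<Rightarrow> int \<Rightarrow> complex" where
  "theta_term e e' z t n = exp (2 * pi * \<i> *
     ((1/2) * (of_int n + of_real e / 2)\<^sup>2 * t + (of_int n + of_real e / 2) * (z + of_real e' / 2)))"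

lemma theta_char_eq_infsum: "theta_char e e' z t = infsum (theta_term e e' z t) UNIV"
  unfolding theta_char_def theta_term_def ..

lemma theta_term_abs_summable:
  assumes "Im t > 0"
  shows "(\<lambda>n. norm (theta_term e e' z t n)) summable_on UNIV"
proof -
  have "theta_term e e' z t n = exp (pi * \<i> * t * (of_int n)\<^sup>2
      + (pi * \<i> * t * e + 2 * pi * \<i> * (z + e' / 2)) * of_int n
      + (pi * \<i> * t * e\<^sup>2 / 4 + pi * \<i> * e * (z + e' / 2)))" for n
    unfolding theta_term_def
    by (intro arg_cong[where f = exp]) (simp add: field_simps power2_eq_square)
  then show ?thesis
    using abs_summable_on_int_gaussian[of "pi * \<i> * t"
        "pi * \<i> * t * e + 2 * pi * \<i> * (z + e' / 2)"
        "pi * \<i> * t * e\<^sup>2 / 4 + pi * \<i> * e * (z + e' / 2)"] assms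
    by simp
qed

text \<open>Absolute convergence turns a product of two theta series into one double series that may
  be reindexed freely.\<close>

lemma has_sum_times_abs_summable:
  fixes f :: "'a \<Rightarrow> complex" and g :: "'b \<Rightarrow> complex"
  assumes "(\<lambda>x. norm (f x)) summable_on A" "(\<lambda>y. norm (g y)) summable_on B"
  shows "((\<lambda>(x, y). f x * g y) has_sum infsum f A * infsum g B) (A \<times> B)"
proof (rule has_sum_SigmaI)
  show "((\<lambda>y. case (x, y) of (x, y) \<Rightarrow> f x * g y) has_sum f x * infsum g B) B" for x
    using has_sum_cmult_right[OF has_sum_infsum[OF abs_summable_summable[OF assms(2)]], of "f x"]
    by simp
  show "((\<lambda>x. f x * infsum g B) has_sum infsum f A * infsum g B) A"
    using has_sum_cmult_left[OF has_sum_infsum[OF abs_summable_summable[OF assms(1)]]] .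
  have "(\<lambda>p. norm (f (fst p) * g (snd p))) summable_on A \<times> B"
  proof (rule summable_on_SigmaI)
    show "((\<lambda>y. norm (f (fst (x, y)) * g (snd (x, y)))) has_sum
        norm (f x) * infsum (\<lambda>y. norm (g y)) B) B" for x
      using has_sum_cmult_right[OF has_sum_infsum[OF assms(2)], of "norm (f x)"]
      by (simp add: norm_mult)
    show "(\<lambda>x. norm (f x) * infsum (\<lambda>y. norm (g y)) B) summable_on A"
      by (rule summable_on_cmult_left[OF assms(1)])
  qed auto
  then show "(\<lambda>(x, y). f x * g y) summable_on A \<times> B"
    by (simp add: case_prod_unfold abs_summable_summable)
qed

lemma exp_add_2pi_int: "exp (2 * pi * \<i> * of_int n + c) = exp c" for c :: complex
  by (simp add: exp_add exp_eq_1)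

text \<open>
  The double series over (m, n) is split by the parity of m + n; on each class the new summation
  indices are (half) the sum and the difference.
\<close>

lemma theta_char_11_mult:
  assumes t: "Im t > 0"
  shows "theta_char 1 1 (x + y) t * theta_char 1 1 (x - y) t
    = theta_char 0 0 (2 * x) (2 * t) * theta_char 1 0 (2 * y) (2 * t)
    - theta_char 1 0 (2 * x) (2 * t) * theta_char 0 0 (2 * y) (2 * t)"
proof -
  let ?f = "\<lambda>(m, n). theta_term 1 1 (x + y) t m * theta_term 1 1 (x - y) t n"
  let ?odd = "{(m, n). odd (m + n :: int)}" and ?even = "{(m, n). even (m + n :: int)}"
  have t2: "Im (2 * t) > 0" using t by simp
  note sums = has_sum_times_abs_summable[OF theta_term_abs_summable theta_term_abs_summable]
  \<comment> \<open>With a = p and b = q + 1/2, the shifted indices m + 1/2 and n + 1/2 are a + b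
    and a - b. Their squares add up to 2 a^2 + 2 b^2, which doubles \<open>t\<close>; the second
    characteristics contribute exp (2 pi i a) = 1.\<close>
  have odd_term: "?f (p + q, p - q - 1) = theta_term 0 0 (2 * x) (2 * t) p * theta_term 1 0 (2 * y) (2 * t) q"
    for p q :: int
  proof -
    have "?f (p + q, p - q - 1) = exp (2 * pi * \<i> * of_int p +
      (2 * pi * \<i> * (1 / 2 * (of_int p)\<^sup>2 * (2 * t) + of_int p * (2 * x))
       + 2 * pi * \<i> * (1 / 2 * (of_int q + 1 / 2)\<^sup>2 * (2 * t) + (of_int q + 1 / 2) * (2 * y))))"
      unfolding theta_term_def case_prod_conv exp_add[symmetric]
      by (intro arg_cong[where f = exp]) (simp add: field_simps power2_eq_square)
    then show ?thesis
      unfolding exp_add_2pi_int theta_term_def by (simp add: exp_add)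
  qed
  \<comment> \<open>Here a = p + 1/2 and b = q, so exp (2 pi i a) = -1 gives the minus sign.\<close>
  have even_term: "?f (p + q, p - q) = - (theta_term 1 0 (2 * x) (2 * t) p * theta_term 0 0 (2 * y) (2 * t) q)"
    for p q :: int
  proof -
    have "?f (p + q, p - q) = exp (2 * pi * \<i> * of_int p + (pi * \<i> +
      (2 * pi * \<i> * (1 / 2 * (of_int p + 1 / 2)\<^sup>2 * (2 * t) + (of_int p + 1 / 2) * (2 * x))
       + 2 * pi * \<i> * (1 / 2 * (of_int q)\<^sup>2 * (2 * t) + of_int q * (2 * y)))))"
      unfolding theta_term_def case_prod_conv exp_add[symmetric]
      by (intro arg_cong[where f = exp]) (simp add: field_simps power2_eq_square)
    then show ?thesis
      unfolding exp_add_2pi_int theta_term_def by (simp add: exp_add)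
  qed
  have odd_inv: "(p + q + (p - q - 1) + 1) div 2 = p" "(p + q - (p - q - 1) - 1) div 2 = q"
    "odd (p + q + (p - q - 1))" for p q :: int
    by presburger+
  have odd_sec: "(m + n + 1) div 2 + (m - n - 1) div 2 = m" "(m + n + 1) div 2 - (m - n - 1) div 2 - 1 = n"
    if "odd (m + n)" for m n :: int
    using that by presburger+
  have even_inv: "(p + q + (p - q)) div 2 = p" "(p + q - (p - q)) div 2 = q" "even (p + q + (p - q))"
    for p q :: int
    by presburger+
  have even_sec: "(m + n) div 2 + (m - n) div 2 = m" "(m + n) div 2 - (m - n) div 2 = n"
    if "even (m + n)" for m n :: int
    using that by presburger+
  have "((\<lambda>(p, q). theta_term 0 0 (2 * x) (2 * t) p * theta_term 1 0 (2 * y) (2 * t) q) has_sum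
      theta_char 0 0 (2 * x) (2 * t) * theta_char 1 0 (2 * y) (2 * t)) (UNIV \<times> UNIV)"
    unfolding theta_char_eq_infsum by (rule sums[OF t2 t2])
  also have "?this \<longleftrightarrow> (?f has_sum
      theta_char 0 0 (2 * x) (2 * t) * theta_char 1 0 (2 * y) (2 * t)) ?odd"
  proof (rule has_sum_reindex_bij_witness[of _ "\<lambda>(m, n). ((m + n + 1) div 2, (m - n - 1) div 2)"
        "\<lambda>(p, q). (p + q, p - q - 1)"])
    show "?f ((\<lambda>(p, q). (p + q, p - q - 1)) a) =
      (case a of (p, q) \<Rightarrow> theta_term 0 0 (2 * x) (2 * t) p * theta_term 1 0 (2 * y) (2 * t) q)" for a
      by (cases a) (simp only: case_prod_conv odd_term[unfolded case_prod_conv])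
  qed (simp_all only: split_paired_all mem_Collect_eq case_prod_conv odd_inv odd_sec UNIV_Times_UNIV UNIV_I not_False_eq_True)
  finally have odd_sum: "(?f has_sum
      theta_char 0 0 (2 * x) (2 * t) * theta_char 1 0 (2 * y) (2 * t)) ?odd" .
  have "((\<lambda>(p, q). - (theta_term 1 0 (2 * x) (2 * t) p * theta_term 0 0 (2 * y) (2 * t) q)) has_sum
      - (theta_char 1 0 (2 * x) (2 * t) * theta_char 0 0 (2 * y) (2 * t))) (UNIV \<times> UNIV)"
    using has_sum_uminusI[OF sums[OF t2 t2]]
    unfolding theta_char_eq_infsum by (simp only: case_prod_unfold)
  also have "?this \<longleftrightarrow> (?f has_sum
      - (theta_char 1 0 (2 * x) (2 * t) * theta_char 0 0 (2 * y) (2 * t))) ?even"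
  proof (rule has_sum_reindex_bij_witness[of _ "\<lambda>(m, n). ((m + n) div 2, (m - n) div 2)"
        "\<lambda>(p, q). (p + q, p - q)"])
    show "?f ((\<lambda>(p, q). (p + q, p - q)) a) =
      (case a of (p, q) \<Rightarrow> - (theta_term 1 0 (2 * x) (2 * t) p * theta_term 0 0 (2 * y) (2 * t) q))" for a
      by (cases a) (simp only: case_prod_conv even_term[unfolded case_prod_conv])
  qed (simp_all only: split_paired_all mem_Collect_eq case_prod_conv even_inv even_sec UNIV_Times_UNIV UNIV_I)
  finally have even_sum: "(?f has_sum
      - (theta_char 1 0 (2 * x) (2 * t) * theta_char 0 0 (2 * y) (2 * t))) ?even" .
  have "(?f has_sum (theta_char 0 0 (2 * x) (2 * t) * theta_char 1 0 (2 * y) (2 * t)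
    + - (theta_char 1 0 (2 * x) (2 * t) * theta_char 0 0 (2 * y) (2 * t)))) (?odd \<union> ?even)"
    by (rule has_sum_Un_disjoint[OF odd_sum even_sum]) auto
  moreover have "?odd \<union> ?even = UNIV \<times> UNIV" by auto
  moreover have "(?f has_sum theta_char 1 1 (x + y) t * theta_char 1 1 (x - y) t) (UNIV \<times> UNIV)"
    unfolding theta_char_eq_infsum by (rule sums[OF t t])
  ultimately show ?thesis
    by (metis (no_types, lifting) has_sum_unique add_uminus_conv_diff)
qed

text \<open>
  By the product formula each T(x + y) T(x - y) is a 2 by 2 determinant, so this is the Pluecker
  relation for a, c, d and 0.
\<close>

lemma theta_char_11_three_term:
  assumes "Im t > 0"
  defines "T \<equiv> \<lambda>z. theta_char 1 1 z t"
  shows "(T a)\<^sup>2 * T (c + d) * T (c - d) - (T c)\<^sup>2 * T (a + d) * T (a - d)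
    = - ((T d)\<^sup>2 * T (a + c) * T (a - c))"
proof -
  have m: "T (x + y) * T (x - y) = theta_char 0 0 (2 * x) (2 * t) * theta_char 1 0 (2 * y) (2 * t)
      - theta_char 1 0 (2 * x) (2 * t) * theta_char 0 0 (2 * y) (2 * t)" for x y
    unfolding T_def by (rule theta_char_11_mult[OF assms(1)])
  have sq: "(T z)\<^sup>2 = theta_char 0 0 (2 * z) (2 * t) * theta_char 1 0 0 (2 * t)
    - theta_char 1 0 (2 * z) (2 * t) * theta_char 0 0 0 (2 * t)" for z
    using m[of z 0] by (simp add: power2_eq_square)
  show ?thesis
    unfolding mult.assoc m sq by algebra
qed

section \<open>Symmetries and change of characteristic\<close>

lemma theta_char_11_plus_1: "theta_char 1 1 (z + 1) t = - theta_char 1 1 z t"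
proof -
  have "theta_term 1 1 (z + 1) t n = - theta_term 1 1 z t n" for n
  proof -
    have "theta_term 1 1 (z + 1) t n = exp (2 * pi * \<i> * of_int n + (pi * \<i> +
      2 * pi * \<i> * ((1/2) * (of_int n + 1 / 2)\<^sup>2 * t + (of_int n + 1 / 2) * (z + 1 / 2))))"
      unfolding theta_term_def by (intro arg_cong[where f = exp]) (simp add: field_simps)
    then show ?thesis
      unfolding exp_add_2pi_int by (simp add: theta_term_def exp_add)
  qed
  then have "theta_term 1 1 (z + 1) t = (\<lambda>n. - theta_term 1 1 z t n)"
    by (rule ext)
  then show ?thesis
    unfolding theta_char_eq_infsum by (simp add: infsum_uminus)
qed

text \<open>The reflection n -> -n - 1 negates n + 1/2; the second characteristic then yields the
  factor exp (-2 pi i (n + 1/2)) = -1.\<close>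

lemma theta_char_11_uminus: "theta_char 1 1 (- z) t = - theta_char 1 1 z t"
proof -
  have "theta_term 1 1 (- z) t (- n - 1) = - theta_term 1 1 z t n" for n
  proof -
    have "theta_term 1 1 (- z) t (- n - 1) = exp (2 * pi * \<i> * of_int (- n - 1) + (pi * \<i> +
      2 * pi * \<i> * ((1/2) * (of_int n + 1 / 2)\<^sup>2 * t + (of_int n + 1 / 2) * (z + 1 / 2))))"
      unfolding theta_term_def
      by (intro arg_cong[where f = exp]) (simp add: field_simps power2_eq_square)
    also have "\<dots> = - theta_term 1 1 z t n"
      unfolding exp_add_2pi_int by (simp add: theta_term_def exp_add)
    finally show ?thesis .
  qed
  moreover have "infsum (theta_term 1 1 (- z) t) UNIV = infsum (\<lambda>n. theta_term 1 1 (- z) t (- n - 1)) UNIV"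
    by (rule infsum_reindex_bij_witness[of _ "\<lambda>n. - n - 1" "\<lambda>n. - n - 1"]) auto
  ultimately show ?thesis
    unfolding theta_char_eq_infsum by (simp add: infsum_uminus)
qed

text \<open>Write n + e/2 = (n + 1/2) + d and expand the square: the cross term moves the argument
  by d t, and the rest is a constant factor. All theta constants thus become values of one odd
  function.\<close>

lemma theta_char_shift_characteristic:
  fixes e e' :: real
  defines "d \<equiv> complex_of_real ((e - 1) / 2)" and "d' \<equiv> complex_of_real ((e' - 1) / 2)"
  shows "theta_char e e' z t = exp (2 * pi * \<i> * (d\<^sup>2 * t / 2 + d * (z + 1 / 2 + d')))
    * theta_char 1 1 (z + d * t + d') t"
  unfolding theta_char_eq_infsum infsum_cmult_right'[symmetric] theta_term_def exp_add[symmetric]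
  by (intro infsum_cong arg_cong[where f = exp])
    (simp add: d_def d'_def field_simps power2_eq_square)

subsection \<open>The quotient formulas\<close>

theorem theorem4p3:
  fixes \<tau> :: complex
  assumes "Im \<tau> > 0"
  defines "A \<equiv> theta_const 1 (1/5) \<tau>"
      and "B \<equiv> theta_const 1 (3/5) \<tau>"
      and "c \<equiv> (\<lambda>k::nat. theta_const (1/5) (real k / 5) \<tau>)"
  shows "(A / B = (c 1 ^ 2 * c 3 - zeta5 ^ 4 * c 9 ^ 2 * c 7)
                 / (zeta5 ^ 2 * c 7 ^ 2 * c 1 - zeta5 ^ 2 * c 3 ^ 2 * c 9)) \<and>
         (A / B = (zeta5 ^ 2 * c 5 ^ 2 * c 7 + c 3 ^ 2 * c 1)
                 / (c 1 ^ 2 * c 5 + zeta5 ^ 2 * c 7 ^ 2 * c 3)) \<and>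
         (A / B = (zeta5 ^ 2 * c 7 ^ 2 * c 5 - zeta5 ^ 2 * c 9 ^ 2 * c 1)
                 / (c 1 ^ 2 * c 7 + zeta5 ^ 2 * c 5 ^ 2 * c 9)) \<and>
         (A / B = (- (c 1 ^ 2 * c 9) + c 3 ^ 2 * c 5)
                 / (zeta5 ^ 2 * c 9 ^ 2 * c 3 + c 5 ^ 2 * c 1)) \<and>
         (A / B = (zeta5 ^ 2 * c 7 ^ 2 * c 9 + c 5 ^ 2 * c 3)
                 / (c 3 ^ 2 * c 7 + zeta5 ^ 2 * c 9 ^ 2 * c 5))"
proof -
  \<comment> \<open>The first characteristic 1/5 gives d = (1/5 - 1)/2 = -2/5. The second one, k/5,
    adds (k - 5)/10, which is a multiple of 1/5 for odd k.\<close>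
  define v where "v = - (2 * \<tau> / 5)"
  define T where "T = (\<lambda>z. theta_char 1 1 z \<tau>)"
  define S where "S = (\<lambda>j::int. T (v + of_int j / 5))"
  define R where "R = (\<lambda>j::int. T (of_int j / 5))"
  define U where "U = (\<lambda>j::int. T (2 * v + of_int j / 5))"
  have lattice: "\<exists>m n :: int. z = of_int m * \<tau> + of_int n" if "T z = 0" for z
    using theta_char_11_eq_0[OF assms(1)] that unfolding T_def by metis
  have shift5: "T (z + of_int (j + 5) / 5) = - T (z + of_int j / 5)" for z j
    using theta_char_11_plus_1[of "z + of_int j / 5" \<tau>]
    by (simp add: T_def add_divide_distrib add.assoc)
  \<comment> \<open>Sums of two points v + i/5 lie over 2v and give \<open>U\<close>; their
    differences are real and give \<open>R\<close>.\<close>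
  have W: "(S a)\<^sup>2 * S (b + d) * S (b - d) - (S b)\<^sup>2 * S (a + d) * S (a - d)
      = - ((R d)\<^sup>2 * U (a + b) * R (a - b))" for a b d
  proof -
    have "v + of_int i / 5 + of_int j / 5 = v + of_int (i + j) / 5"
      "v + of_int i / 5 - of_int j / 5 = v + of_int (i - j) / 5"
      "v + of_int i / 5 + (v + of_int j / 5) = 2 * v + of_int (i + j) / 5"
      "v + of_int i / 5 - (v + of_int j / 5) = of_int (i - j) / 5" for i j :: int
      by (simp_all add: add_divide_distrib diff_divide_distrib)
    then show ?thesis
      using theta_char_11_three_term[OF assms(1), of "v + of_int a / 5" "v + of_int b / 5" "of_int d / 5"]
      by (simp only: S_def R_def U_def T_def)
  qed
  have S_eqs: "S 3 = - S (-2)" "S 4 = - S (-1)" "S (-3) = - S 2" "S (-4) = - S 1"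
    using shift5[of v "-2"] shift5[of v "-1"] shift5[of v "-3"] shift5[of v "-4"]
    by (simp_all add: S_def)
  have U_eqs: "U 3 = - U (-2)" "U 2 = - U (-3)"
    using shift5[of "2 * v" "-2"] shift5[of "2 * v" "-3"] by (simp_all add: U_def)
  \<comment> \<open>With first characteristic 1 the exponential factor is 1, and the arguments are
    (1/5 - 1)/2 = -2/5 and (3/5 - 1)/2 = -1/5.\<close>
  have AB: "A = R (-2)" "B = R (-1)"
    by (simp_all add: A_def B_def theta_const_def R_def T_def
        theta_char_shift_characteristic[of 1 "1/5"] theta_char_shift_characteristic[of 1 "3/5"])
  have R_minus: "R (- j) = - R j" for j
    using theta_char_11_uminus[of "of_int j / 5" \<tau>] by (simp add: R_def T_def)
  have R_eqs: "R 1 = - B" "R 2 = - A" "R (-1) = B" "R (-2) = A" "R (-3) = A" "R (-4) = B"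
    using R_minus[of 1] R_minus[of 2] R_minus[of 3] R_minus[of 4]
      shift5[of 0 "-2"] shift5[of 0 "-1"]
    by (simp_all add: AB R_def)
  have R_nonzero: "R j \<noteq> 0" if "\<not> 5 dvd j" for j
  proof
    assume "R j = 0"
    then obtain m n :: int where mn: "of_int j / 5 = of_int m * \<tau> + of_int n"
      using lattice unfolding R_def by blast
    from arg_cong[where f = Im, OF mn] have "m = 0"
      using assms(1) by simp
    with mn have "complex_of_int j = of_int (5 * n)"
      by simp
    then have "j = 5 * n"
      by (simp only: of_int_eq_iff)
    with that show False by simp
  qed
  have A0: "A \<noteq> 0" and B0: "B \<noteq> 0"
    using R_nonzero[of "-2"] R_nonzero[of "-1"] AB by simp_all
  have U_nonzero: "U j \<noteq> 0" for j
  proof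
    assume "U j = 0"
    then obtain m n :: int where mn: "2 * v + of_int j / 5 = of_int m * \<tau> + of_int n"
      using lattice unfolding U_def by blast
    \<comment> \<open>The imaginary part of 2v is -4/5 of that of \<tau>, never an integer multiple
      of it.\<close>
    from arg_cong[where f = Im, OF mn] have "- (4 / 5) * Im \<tau> = of_int m * Im \<tau>"
      by (simp add: v_def)
    then have "(5 * real_of_int m + 4) * Im \<tau> = 0"
      by (simp add: algebra_simps)
    then have "real_of_int (5 * m + 4) = real_of_int 0"
      using assms(1) by simp
    then have "5 * m + 4 = 0"
      by (simp only: of_int_eq_iff)
    then show False by presburger
  qed
  \<comment> \<open>The root of unity w is chosen with w^5 = zeta5, and H such that c 9 = H * S 2; then all
    monomials within one of the five quotients carry the same power of w.\<close>
  define w where "w = exp (2 * pi * \<i> / 25)"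
  define H where "H = exp (2 * pi * \<i> * (2 * \<tau> / 25 - 9 / 25))"
  have w0: "w \<noteq> 0" and H0: "H \<noteq> 0"
    by (simp_all add: w_def H_def)
  have zeta5: "zeta5 = w ^ 5"
    by (simp add: zeta5_def w_def mult_ac flip: exp_of_nat_mult)
  \<comment> \<open>The change of characteristic produces exp (2 pi i (2 \<tau> - k) / 25). Taking
    out its value \<open>H\<close> at k = 9 leaves \<open>w ^ (9 - k)\<close>, a natural power for
    \<open>k \<le> 9\<close>.\<close>
  have c: "c k = H * w ^ (9 - k) * T (v + (of_nat k - 5) / 10)" if "k \<le> 9" for k
  proof -
    have chars: "complex_of_real ((1 / 5 - 1) / 2) = - (2 / 5)"
      "complex_of_real ((real k / 5 - 1) / 2) = (of_nat k - 5) / 10"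
      by (simp_all add: field_simps)
    have arg: "0 + - (2 / 5) * \<tau> + (of_nat k - 5) / 10 = v + (of_nat k - 5) / 10"
      by (simp add: v_def)
    have "c k = exp (2 * pi * \<i> * ((- (2 / 5))\<^sup>2 * \<tau> / 2 + - (2 / 5) * (0 + 1 / 2 + (of_nat k - 5) / 10)))
        * T (v + (of_nat k - 5) / 10)"
      unfolding c_def theta_const_def theta_char_shift_characteristic[of "1 / 5"] T_def chars arg ..
    also have "(- (2 / 5))\<^sup>2 * \<tau> / 2 + - (2 / 5) * (0 + 1 / 2 + (of_nat k - 5) / 10)
        = 2 * \<tau> / 25 - of_nat k / 25"
      by (simp add: field_simps power2_eq_square)
    also have "exp (2 * pi * \<i> * (2 * \<tau> / 25 - of_nat k / 25)) = H * w ^ (9 - k)"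
      unfolding H_def w_def exp_of_nat_mult[symmetric] exp_add[symmetric] of_nat_diff[OF that]
      by (intro arg_cong[where f = exp]) (simp add: field_simps)
    finally show ?thesis .
  qed
  have cs: "c 1 = H * w ^ 8 * S (-2)" "c 3 = H * w ^ 6 * S (-1)" "c 5 = H * w ^ 4 * S 0"
    "c 7 = H * w ^ 2 * S 1" "c 9 = H * S 2"
    using c[of 1] c[of 3] c[of 5] c[of 7] c[of 9] by (simp_all add: S_def)
  \<comment> \<open>Nonvanishing of \<open>s\<close> and \<open>D\<close> is forced by
    \<open>D * s\<close>, since A, B and \<open>u\<close> are nonzero.\<close>
  have ratio: "A / B = X / Y"
    if X: "X = H ^ 3 * w ^ m * N" and Y: "Y = H ^ 3 * w ^ m * D"
      and N: "N * s = A\<^sup>2 * B * u" and D: "D * s = A * B\<^sup>2 * u" and u: "u \<noteq> 0" for X Y N D s u m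
  proof -
    have "D \<noteq> 0" "s \<noteq> 0"
      using D A0 B0 u by auto
    moreover have "(A * D - B * N) * s = 0"
      using N D by algebra
    ultimately have "A / B = N / D"
      using B0 by (simp add: field_simps)
    then show ?thesis
      using X Y H0 w0 by simp
  qed
  note norms = S_eqs U_eqs R_eqs
  show ?thesis
  proof (intro conjI)
    show "A / B = (c 1 ^ 2 * c 3 - zeta5 ^ 4 * c 9 ^ 2 * c 7)
                 / (zeta5 ^ 2 * c 7 ^ 2 * c 1 - zeta5 ^ 2 * c 3 ^ 2 * c 9)"
    \<comment> \<open>The number 22 is the common exponent of \<open>w\<close>: for instance
      \<open>c 1 ^ 2 * c 3\<close> contributes 16 + 6, and \<open>zeta5 ^ 4 * c 9 ^ 2 * c 7\<close>
      contributes 20 + 2.\<close>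
    proof (rule ratio[of _ 22 "(S (-2))\<^sup>2 * S (-1) - (S 2)\<^sup>2 * S 1" _
          "(S 1)\<^sup>2 * S (-2) - (S (-1))\<^sup>2 * S 2" "S 0" "U 0"])
      \<comment> \<open>In each instance of \<open>W\<close>, a and b are the indices of the squared
        constants. A numerator takes d = 2 or -2 with a - b = 1 or -1 modulo 5, giving A^2 B; a
        denominator takes d = 1 or -1 with a - b = 2 or -2 modulo 5, giving A B^2. Within a quotient
        both sums a + b agree modulo 5, so the same \<open>U\<close> value appears up to
        sign.\<close>
      show "((S (-2))\<^sup>2 * S (-1) - (S 2)\<^sup>2 * S 1) * S 0 = A\<^sup>2 * B * U 0"
        using W[of "-2" 2 2, simplified, unfolded norms] by algebra
      show "((S 1)\<^sup>2 * S (-2) - (S (-1))\<^sup>2 * S 2) * S 0 = A * B\<^sup>2 * U 0"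
        using W[of 1 "-1" "-1", simplified, unfolded norms] by algebra
    qed (simp_all only: cs zeta5 U_nonzero not_False_eq_True, algebra+)
  next
    show "A / B = (zeta5 ^ 2 * c 5 ^ 2 * c 7 + c 3 ^ 2 * c 1)
                 / (c 1 ^ 2 * c 5 + zeta5 ^ 2 * c 7 ^ 2 * c 3)"
    proof (rule ratio[of _ 20 "(S 0)\<^sup>2 * S 1 + (S (-1))\<^sup>2 * S (-2)" _
          "(S (-2))\<^sup>2 * S 0 + (S 1)\<^sup>2 * S (-1)" "S 2" "- U (-1)"])
      show "((S 0)\<^sup>2 * S 1 + (S (-1))\<^sup>2 * S (-2)) * S 2 = A\<^sup>2 * B * - U (-1)"
        using W[of 0 "-1" 2, simplified, unfolded norms] by algebra
      show "((S (-2))\<^sup>2 * S 0 + (S 1)\<^sup>2 * S (-1)) * S 2 = A * B\<^sup>2 * - U (-1)"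
        using W[of "-2" 1 "-1", simplified, unfolded norms] by algebra
    qed (simp_all only: cs zeta5 neg_equal_0_iff_equal U_nonzero not_False_eq_True, algebra+)
  next
    show "A / B = (zeta5 ^ 2 * c 7 ^ 2 * c 5 - zeta5 ^ 2 * c 9 ^ 2 * c 1)
                 / (c 1 ^ 2 * c 7 + zeta5 ^ 2 * c 5 ^ 2 * c 9)"
    proof (rule ratio[of _ 18 "(S 1)\<^sup>2 * S 0 - (S 2)\<^sup>2 * S (-2)" _
          "(S (-2))\<^sup>2 * S 1 + (S 0)\<^sup>2 * S 2" "S (-1)" "- U (-2)"])
      show "((S 1)\<^sup>2 * S 0 - (S 2)\<^sup>2 * S (-2)) * S (-1) = A\<^sup>2 * B * - U (-2)"
        using W[of 1 2 "-2", simplified, unfolded norms] by algebra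
      show "((S (-2))\<^sup>2 * S 1 + (S 0)\<^sup>2 * S 2) * S (-1) = A * B\<^sup>2 * - U (-2)"
        using W[of "-2" 0 1, simplified, unfolded norms] by algebra
    qed (simp_all only: cs zeta5 neg_equal_0_iff_equal U_nonzero not_False_eq_True, algebra+)
  next
    show "A / B = (- (c 1 ^ 2 * c 9) + c 3 ^ 2 * c 5)
                 / (zeta5 ^ 2 * c 9 ^ 2 * c 3 + c 5 ^ 2 * c 1)"
    proof (rule ratio[of _ 16 "- ((S (-2))\<^sup>2 * S 2) + (S (-1))\<^sup>2 * S 0" _
          "(S 2)\<^sup>2 * S (-1) + (S 0)\<^sup>2 * S (-2)" "S 1" "- U (-3)"])
      show "(- ((S (-2))\<^sup>2 * S 2) + (S (-1))\<^sup>2 * S 0) * S 1 = A\<^sup>2 * B * - U (-3)"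
        using W[of "-2" "-1" "-2", simplified, unfolded norms] by algebra
      show "((S 2)\<^sup>2 * S (-1) + (S 0)\<^sup>2 * S (-2)) * S 1 = A * B\<^sup>2 * - U (-3)"
        using W[of 2 0 "-1", simplified, unfolded norms] by algebra
    qed (simp_all only: cs zeta5 neg_equal_0_iff_equal U_nonzero not_False_eq_True, algebra+)
  next
    show "A / B = (zeta5 ^ 2 * c 7 ^ 2 * c 9 + c 5 ^ 2 * c 3)
                 / (c 3 ^ 2 * c 7 + zeta5 ^ 2 * c 9 ^ 2 * c 5)"
    proof (rule ratio[of _ 14 "(S 1)\<^sup>2 * S 2 + (S 0)\<^sup>2 * S (-1)" _
          "(S (-1))\<^sup>2 * S 1 + (S 2)\<^sup>2 * S 0" "S (-2)" "U 1"])
      show "((S 1)\<^sup>2 * S 2 + (S 0)\<^sup>2 * S (-1)) * S (-2) = A\<^sup>2 * B * U 1"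
        using W[of 1 0 2, simplified, unfolded norms] by algebra
      show "((S (-1))\<^sup>2 * S 1 + (S 2)\<^sup>2 * S 0) * S (-2) = A * B\<^sup>2 * U 1"
        using W[of "-1" 2 "-1", simplified, unfolded norms] by algebra
    qed (simp_all only: cs zeta5 U_nonzero not_False_eq_True, algebra+)
  qed
qed

end
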